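(* Consider the adjacency-list model augmented with $\texttt{JUMP}$, $\texttt{IN-SORTED}$ and $\texttt{ADJ}$. For any $n$ and $m$ with $n\le m\le n^2$ and any $\delta\in(0,1]$, there exists a directed graph $G=(V,E)$ with $\Theta(n)$ nodes, $\Theta(m)$ edges, and a node $s\in V$, such that for any algorithm solving the single-source problem, the expected running time on $G$ with source $s$ and approximation threshold $\delta$ is $\Omega(\min\{m,1/\delta\})$.
   Context: Fix a constant $\alpha\in(0,1)$. For a directed graph $G=(V,E)$, an $\alpha$-discounted random walk from a node $s$: at each step, with probability $\alpha$ it terminates at the current node, and otherwise it moves to a uniformly random out-neighbor of the current node. $\pi(s,t)$ is the probability that such a walk from $s$ terminates at $t$. Adjacency-list model: an algorithm accesses $G$ only through constant-time queries $\texttt{DEG-IN}(u)$, $\texttt{DEG-OUT}(u)$ (in-/out-degree of $u$), $\texttt{IN}(u,i)$, $\texttt{OUT}(u,i)$ ($i$-th in-/out-neighbor of $u$). Additional queries: $\texttt{ADJ}(u,v)$ returns whether $(u,v)\in E$; $\texttt{IN-SORTED}(u,i)$ returns the $i$-th in-neighbor of $u$ when in-neighbors are sorted by out-degree; $\texttt{JUMP}()$ returns a uniformly random node of $V$. Single-source problem: given $G$ (via queries), a source $s\in V$ and $\delta\in(0,1]$, output estimates $\hat\pi(s,t)$ for all $t\in V$ such that for each $t$, $\Pr\{|\hat\pi(s,t)-\pi(s,t)|\ge\varepsilon\max\{\pi(s,t),\delta\}\}\le p_f$, where $\varepsilon,p_f$ are fixed small constants; an algorithm solves the problem if this holds for every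 input. *)

theory Defs
  imports "HOL-Probability.Probability" "Graph_Theory.Pair_Digraph"
begin

text \<open>
  Self-loops are permitted. A walk has to be able to move on from every node, so every node has an
  out-neighbour.
\<close>

definition walk_graph :: "nat pair_pre_digraph \<Rightarrow> bool" where
  "walk_graph G \<longleftrightarrow>
     pair_fin_digraph G \<and> (\<forall>u\<in>pverts G. out_degree (with_proj G) u \<ge> 1)"

datatype walk_state = At nat | Stopped nat

context
  fixes \<alpha> :: real and G :: "nat pair_pre_digraph"
begin

fun walk_step :: "walk_state \<Rightarrow> walk_state pmf" where
  "walk_step (At u) =
     bind_pmf (bernoulli_pmf \<alpha>)
       (\<lambda>stop. if stop then return_pmf (Stopped u)
               else map_pmf At (pmf_of_set {v. (u, v) \<in> parcs G}))"
| "walk_step (Stopped u) = return_pmf (Stopped u)"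

fun walk_after :: "nat \<Rightarrow> nat \<Rightarrow> walk_state pmf" where
  "walk_after s 0 = return_pmf (At s)"
| "walk_after s (Suc k) = bind_pmf (walk_after s k) walk_step"

text \<open>
  The probability of having stopped at \<open>t\<close> is nondecreasing in the number of steps, so the
  supremum is the probability that the walk ever terminates at \<open>t\<close>.
\<close>

definition ppr :: "nat \<Rightarrow> nat \<Rightarrow> real" where
  "ppr s t = (SUP k. pmf (walk_after s k) (Stopped t))"

end

text \<open>
  The queries see the neighbours of a node in an order that the graph itself does not determine
  (for \<open>sorted_in_list\<close>: not among in-neighbours of equal out-degree).
  An input is a graph together with such a choice of lists.
\<close>

record adj_lists =
  in_list :: "nat \<Rightarrow> nat list"
  out_list :: "nat \<Rightarrow> nat list"
  sorted_in_list :: "nat \<Rightarrow> nat list"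

definition adj_lists_of :: "nat pair_pre_digraph \<Rightarrow> adj_lists \<Rightarrow> bool" where
  "adj_lists_of G L \<longleftrightarrow> (\<forall>u\<in>pverts G.
     distinct (in_list L u) \<and> set (in_list L u) = {v. (v, u) \<in> parcs G} \<and>
     distinct (out_list L u) \<and> set (out_list L u) = {v. (u, v) \<in> parcs G} \<and>
     distinct (sorted_in_list L u) \<and> set (sorted_in_list L u) = {v. (v, u) \<in> parcs G} \<and>
     sorted (map (out_degree (with_proj G)) (sorted_in_list L u)))"

datatype query =
    DEG_IN nat
  | DEG_OUT nat
  | IN nat nat
  | OUT nat nat
  | ADJ nat nat
  | IN_SORTED nat nat
  | JUMP

datatype answer = Number nat | Node nat | Truth bool | Invalid

text \<open>Neighbours are indexed from 0.\<close>

definition entry :: "nat set \<Rightarrow> (nat \<Rightarrow> nat list) \<Rightarrow> nat \<Rightarrow> nat \<Rightarrow> answer" where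
  "entry V l u i = (if u \<in> V \<and> i < length (l u) then Node (l u ! i) else Invalid)"

fun reply :: "nat pair_pre_digraph \<Rightarrow> adj_lists \<Rightarrow> query \<Rightarrow> answer pmf" where
  "reply G L (DEG_IN u) =
     return_pmf (if u \<in> pverts G then Number (in_degree (with_proj G) u) else Invalid)"
| "reply G L (DEG_OUT u) =
     return_pmf (if u \<in> pverts G then Number (out_degree (with_proj G) u) else Invalid)"
| "reply G L (IN u i) = return_pmf (entry (pverts G) (in_list L) u i)"
| "reply G L (OUT u i) = return_pmf (entry (pverts G) (out_list L) u i)"
| "reply G L (ADJ u v) = return_pmf (Truth ((u, v) \<in> parcs G))"
| "reply G L (IN_SORTED u i) = return_pmf (entry (pverts G) (sorted_in_list L) u i)"
| "reply G L JUMP = map_pmf Node (pmf_of_set (pverts G))"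

text \<open>
  A randomized adaptive algorithm chooses its next action from the answers it has received so far
  (most recent first). Its internal randomness consists of \<open>Sample\<close> actions, whose
  results are recorded among the answers. \<open>Halt e\<close> outputs the estimates \<open>e\<close>.
\<close>

datatype action = Query query | Sample "nat pmf" | Halt "nat \<Rightarrow> real"

type_synonym strategy = "answer list \<Rightarrow> action"

text \<open>
  The arguments are the set of node names, the source and the threshold; the edges are accessible
  through queries only.
\<close>

type_synonym algorithm = "nat set \<Rightarrow> nat \<Rightarrow> real \<Rightarrow> strategy"

context
  fixes G :: "nat pair_pre_digraph" and L :: adj_lists and \<sigma> :: strategy
begin

definition run_step :: "answer list \<Rightarrow> answer list pmf" where
  "run_step h = (case \<sigma> h of
       Query q \<Rightarrow> map_pmf (\<lambda>a. a # h) (reply G L q)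
     | Sample p \<Rightarrow> map_pmf (\<lambda>k. Number k # h) p
     | Halt e \<Rightarrow> return_pmf h)"

fun run_after :: "nat \<Rightarrow> answer list pmf" where
  "run_after 0 = return_pmf []"
| "run_after (Suc k) = bind_pmf (run_after k) run_step"

text \<open>
  The probability that the run halts with an output satisfying \<open>P\<close>; a run that
  never halts does not contribute. The sequence is nondecreasing.
\<close>

definition output_prob :: "((nat \<Rightarrow> real) \<Rightarrow> bool) \<Rightarrow> real" where
  "output_prob P =
     (SUP k. measure_pmf.prob (run_after k) {h. \<exists>e. \<sigma> h = Halt e \<and> P e})"

text \<open>
  Every action, including the final \<open>Halt\<close>, takes one unit of time; computation between
  actions is free. A run that halts with history \<open>h\<close> has taken time
  \<open>length h + 1\<close>; the supremum is the expectation by monotone convergence, and it is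
  infinite if the run fails to halt with positive probability.
\<close>

definition expected_time :: ennreal where
  "expected_time = (SUP k. \<integral>\<^sup>+ h. of_nat (length h + 1) \<partial>measure_pmf (run_after k))"

end

definition solves_single_source :: "real \<Rightarrow> real \<Rightarrow> real \<Rightarrow> algorithm \<Rightarrow> bool" where
  "solves_single_source \<alpha> \<epsilon> p\<^sub>f A \<longleftrightarrow>
     (\<forall>G L s \<delta>. walk_graph G \<and> adj_lists_of G L \<and> s \<in> pverts G \<and> 0 < \<delta> \<and> \<delta> \<le> 1 \<longrightarrow>
       (\<forall>t\<in>pverts G.
          1 - output_prob G L (A (pverts G) s \<delta>)
                (\<lambda>e. \<not> \<bar>e t - ppr \<alpha> G s t\<bar> \<ge> \<epsilon> * max (ppr \<alpha> G s t) \<delta>) \<le> p\<^sub>f))"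

end

theory Submission
  imports Defs
begin

text \<open>
  The hard input consists of two disjoint copies of one digraph, in which the source reaches each of
  \<open>K = \<Theta>(min m (1/\<delta>))\<close> critical arcs with probability \<open>\<Theta>(1/K)\<close>. Crossing
  the two copies of one critical arc makes a node of the other copy reachable with probability at
  least \<open>\<delta> / (1 - \<epsilon>)\<close>, whereas before it was unreachable, so the estimate at this node has
  to change. Crossing preserves all degrees, and each query has a different reply for at most one of
  the \<open>K\<close> crossed inputs. Hence an algorithm has to ask, with probability bounded below, a query
  specific to each of the critical arcs, which takes \<open>\<Omega>(K)\<close> queries in expectation.
\<close>

section \<open>Runs and the queries they ask\<close>

fun queries :: "strategy \<Rightarrow> answer list \<Rightarrow> query set" where
  "queries \<sigma> [] = {}"
| "queries \<sigma> (a # h) = queries \<sigma> h \<union> {q. \<sigma> h = Query q}"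

lemma finite_queries: "finite (queries \<sigma> h)"
proof (induction h)
  case (Cons a h)
  moreover have "finite {q. \<sigma> h = Query q}" by (cases "\<sigma> h") simp_all
  ultimately show ?case by simp
qed simp

lemma card_queries_le_length: "card (queries \<sigma> h) \<le> length h"
proof (induction h)
  case (Cons a h)
  moreover have "card {q. \<sigma> h = Query q} \<le> 1" by (cases "\<sigma> h") simp_all
  ultimately show ?case
    using card_Un_le[of "queries \<sigma> h" "{q. \<sigma> h = Query q}"] by simp
qed simp

lemma queries_mono_run_step:
  "h \<in> set_pmf (run_step G L \<sigma> h') \<Longrightarrow> queries \<sigma> h' \<subseteq> queries \<sigma> h"
  by (auto simp: run_step_def split: action.splits)

lemma pmf_run_step_cong:
  assumes "\<And>q. q \<in> queries \<sigma> h \<Longrightarrow> reply G L q = reply G' L' q"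
  shows "pmf (run_step G L \<sigma> h') h = pmf (run_step G' L' \<sigma> h') h"
proof (cases "\<sigma> h'")
  case (Query q)
  show ?thesis
  proof (cases "\<exists>a. h = a # h'")
    case True
    with Query assms have "reply G L q = reply G' L' q" by auto
    with Query show ?thesis by (simp add: run_step_def)
  next
    case False
    with Query show ?thesis by (simp add: run_step_def pmf_map_outside image_iff)
  qed
qed (simp_all add: run_step_def)

lemma pmf_run_after_cong:
  assumes "\<And>q. q \<in> queries \<sigma> h \<Longrightarrow> reply G L q = reply G' L' q"
  shows "pmf (run_after G L \<sigma> k) h = pmf (run_after G' L' \<sigma> k) h"
  using assms
proof (induction k arbitrary: h)
  case (Suc k)
  have last_step: "ennreal (pmf (run_after G L \<sigma> (Suc k)) h) =
      (\<integral>\<^sup>+h'. ennreal (pmf (run_after G L \<sigma> k) h' * pmf (run_step G L \<sigma> h') h) \<partial>count_space UNIV)"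
    for G L
    by (simp add: ennreal_pmf_bind nn_integral_measure_pmf ennreal_mult)
  have "pmf (run_after G L \<sigma> k) h' * pmf (run_step G L \<sigma> h') h =
      pmf (run_after G' L' \<sigma> k) h' * pmf (run_step G' L' \<sigma> h') h" for h'
  proof (cases "h \<in> set_pmf (run_step G L \<sigma> h')")
    case True
    then show ?thesis
      using Suc.IH[of h'] Suc.prems queries_mono_run_step pmf_run_step_cong[OF Suc.prems]
      by (metis subsetD)
  next
    case False
    then show ?thesis
      using pmf_run_step_cong[of \<sigma> h G L G' L' h', OF Suc.prems] by (simp add: set_pmf_iff)
  qed
  then have "ennreal (pmf (run_after G L \<sigma> (Suc k)) h) =
      ennreal (pmf (run_after G' L' \<sigma> (Suc k)) h)"
    unfolding last_step by simp
  then show ?case by simp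
qed simp

lemma prob_add_le_of_pmf_eq_outside:
  assumes "\<And>x. x \<notin> Z \<Longrightarrow> pmf M x = pmf N x" and "S \<inter> T = {}"
  shows "measure_pmf.prob M S + measure_pmf.prob N T \<le> 1 + measure_pmf.prob M Z"
proof -
  have prob_eq: "measure_pmf.prob M A = measure_pmf.prob N A" if "A \<inter> Z = {}" for A
  proof -
    have "emeasure (measure_pmf M) A = emeasure (measure_pmf N) A"
      unfolding nn_integral_pmf[symmetric] using assms(1) that by (intro nn_integral_cong) auto
    then show ?thesis by (simp add: measure_def)
  qed
  have complement: "measure_pmf.prob M (UNIV - Z) = measure_pmf.prob N (UNIV - Z)"
    by (rule prob_eq) auto
  have "measure_pmf.prob N T \<le> measure_pmf.prob N (T - Z) + measure_pmf.prob N Z"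
    using measure_pmf.finite_measure_mono[of T "(T - Z) \<union> Z" N]
      measure_Un_le[of "T - Z" "measure_pmf N" Z] by auto
  also have "measure_pmf.prob N (T - Z) = measure_pmf.prob M (T - Z)"
    by (rule prob_eq[symmetric]) auto
  also have "measure_pmf.prob N Z = measure_pmf.prob M Z"
    using complement measure_pmf.prob_compl[of Z M] measure_pmf.prob_compl[of Z N] by simp
  finally have "measure_pmf.prob N T \<le> measure_pmf.prob M (T - Z) + measure_pmf.prob M Z" .
  moreover have "measure_pmf.prob M S + measure_pmf.prob M (T - Z) =
      measure_pmf.prob M (S \<union> (T - Z))"
    using assms(2) by (intro measure_pmf.finite_measure_Union[symmetric]) auto
  ultimately show ?thesis
    using measure_pmf.prob_le_1[of M "S \<union> (T - Z)"] by linarith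
qed

section \<open>Output and running time\<close>

definition halted :: "strategy \<Rightarrow> ((nat \<Rightarrow> real) \<Rightarrow> bool) \<Rightarrow> answer list set" where
  "halted \<sigma> P = {h. \<exists>e. \<sigma> h = Halt e \<and> P e}"

definition asking :: "strategy \<Rightarrow> query set \<Rightarrow> answer list set" where
  "asking \<sigma> D = {h. queries \<sigma> h \<inter> D \<noteq> {}}"

lemma incseq_prob_halted: "incseq (\<lambda>k. measure_pmf.prob (run_after G L \<sigma> k) (halted \<sigma> P))"
proof (rule incseq_SucI)
  fix k
  have "emeasure (measure_pmf (run_after G L \<sigma> k)) (halted \<sigma> P) =
      (\<integral>\<^sup>+h. indicator (halted \<sigma> P) h \<partial>measure_pmf (run_after G L \<sigma> k))"
    by simp
  also have "\<dots> \<le> (\<integral>\<^sup>+h. emeasure (measure_pmf (run_step G L \<sigma> h)) (halted \<sigma> P)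
      \<partial>measure_pmf (run_after G L \<sigma> k))"
    by (intro nn_integral_mono) (auto simp: halted_def run_step_def indicator_def)
  also have "\<dots> = emeasure (measure_pmf (run_after G L \<sigma> (Suc k))) (halted \<sigma> P)"
    by simp
  finally show "measure_pmf.prob (run_after G L \<sigma> k) (halted \<sigma> P) \<le>
      measure_pmf.prob (run_after G L \<sigma> (Suc k)) (halted \<sigma> P)"
    by (simp add: measure_pmf.emeasure_eq_measure)
qed

lemma prob_halted_tendsto_output_prob:
  "(\<lambda>k. measure_pmf.prob (run_after G L \<sigma> k) (halted \<sigma> P)) \<longlonglongrightarrow> output_prob G L \<sigma> P"
  unfolding output_prob_def halted_def[symmetric]
  by (rule LIMSEQ_incseq_SUP[OF bdd_aboveI[of _ 1] incseq_prob_halted]) auto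

lemma nn_integral_length_le_expected_time:
  "(\<integral>\<^sup>+h. of_nat (length h + 1) \<partial>measure_pmf (run_after G L \<sigma> k)) \<le> expected_time G L \<sigma>"
  unfolding expected_time_def by (rule SUP_upper) simp

lemma one_le_expected_time: "1 \<le> expected_time G L \<sigma>"
  using nn_integral_length_le_expected_time[of G L \<sigma> 0] by simp

lemma card_asking_le_length:
  assumes "\<And>q. card {i \<in> I. q \<in> D i} \<le> d"
  shows "card {i \<in> I. h \<in> asking \<sigma> (D i)} \<le> d * length h"
proof -
  have "{i \<in> I. h \<in> asking \<sigma> (D i)} = (\<Union>q\<in>queries \<sigma> h. {i \<in> I. q \<in> D i})"
    by (auto simp: asking_def)
  also have "card \<dots> \<le> (\<Sum>q\<in>queries \<sigma> h. card {i \<in> I. q \<in> D i})"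
    by (rule card_UN_le[OF finite_queries])
  also have "\<dots> \<le> card (queries \<sigma> h) * d"
    using sum_bounded_above[of "queries \<sigma> h" "\<lambda>q. card {i \<in> I. q \<in> D i}" d] assms by simp
  also have "\<dots> \<le> d * length h"
    using card_queries_le_length by (simp add: mult.commute)
  finally show ?thesis .
qed

lemma sum_prob_asking_le_expected_time:
  assumes "finite I" and "\<And>q. card {i \<in> I. q \<in> D i} \<le> d"
  shows "ennreal (\<Sum>i\<in>I. measure_pmf.prob (run_after G L \<sigma> k) (asking \<sigma> (D i))) \<le>
    of_nat d * expected_time G L \<sigma>"
proof -
  let ?M = "measure_pmf (run_after G L \<sigma> k)"
  have "ennreal (\<Sum>i\<in>I. measure ?M (asking \<sigma> (D i))) = (\<Sum>i\<in>I. emeasure ?M (asking \<sigma> (D i)))"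
    by (subst sum_ennreal[symmetric]) (auto simp: measure_pmf.emeasure_eq_measure)
  also have "\<dots> = (\<integral>\<^sup>+h. (\<Sum>i\<in>I. indicator (asking \<sigma> (D i)) h) \<partial>?M)"
    by (simp add: nn_integral_sum)
  also have "\<dots> = (\<integral>\<^sup>+h. of_nat (card {i \<in> I. h \<in> asking \<sigma> (D i)}) \<partial>?M)"
    using \<open>finite I\<close> by (simp add: indicator_def sum.If_cases Int_def)
  also have "\<dots> \<le> (\<integral>\<^sup>+h. of_nat (d * (length h + 1)) \<partial>?M)"
    using card_asking_le_length[OF assms(2), of _ \<sigma>]
    by (intro nn_integral_mono of_nat_mono) (meson le_add1 mult_le_mono2 order_trans)
  also have "\<dots> = of_nat d * (\<integral>\<^sup>+h. of_nat (length h + 1) \<partial>?M)"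
    by (simp only: of_nat_mult) (rule nn_integral_cmult, simp)
  also have "\<dots> \<le> of_nat d * expected_time G L \<sigma>"
    by (intro mult_left_mono nn_integral_length_le_expected_time) simp
  finally show ?thesis .
qed

lemma sum_output_prob_le_expected_time:
  assumes "finite I" and overlap: "\<And>q. card {i \<in> I. q \<in> D i} \<le> d"
    and same: "\<And>i q. i \<in> I \<Longrightarrow> q \<notin> D i \<Longrightarrow> reply (G' i) (L' i) q = reply G L q"
    and incompatible: "\<And>i e. i \<in> I \<Longrightarrow> \<not> (P i e \<and> Q i e)"
  shows "ennreal (\<Sum>i\<in>I. output_prob G L \<sigma> (P i) + output_prob (G' i) (L' i) \<sigma> (Q i) - 1) \<le>
    of_nat d * expected_time G L \<sigma>"
proof (rule LIMSEQ_le_const2)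
  let ?p = "\<lambda>k. measure_pmf.prob (run_after G L \<sigma> k)"
  let ?p' = "\<lambda>i k. measure_pmf.prob (run_after (G' i) (L' i) \<sigma> k)"
  show "(\<lambda>k. ennreal (\<Sum>i\<in>I. ?p k (halted \<sigma> (P i)) + ?p' i k (halted \<sigma> (Q i)) - 1)) \<longlonglongrightarrow>
      ennreal (\<Sum>i\<in>I. output_prob G L \<sigma> (P i) + output_prob (G' i) (L' i) \<sigma> (Q i) - 1)"
    by (intro tendsto_ennrealI tendsto_intros prob_halted_tendsto_output_prob)
  have "?p k (halted \<sigma> (P i)) + ?p' i k (halted \<sigma> (Q i)) - 1 \<le> ?p k (asking \<sigma> (D i))"
    if "i \<in> I" for i k
  proof -
    have "pmf (run_after G L \<sigma> k) h = pmf (run_after (G' i) (L' i) \<sigma> k) h"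
      if "h \<notin> asking \<sigma> (D i)" for h
      using that
      by (intro pmf_run_after_cong same[OF \<open>i \<in> I\<close>, symmetric]) (auto simp: asking_def)
    moreover have "halted \<sigma> (P i) \<inter> halted \<sigma> (Q i) = {}"
      using incompatible[OF \<open>i \<in> I\<close>] by (auto simp: halted_def)
    ultimately have "?p k (halted \<sigma> (P i)) + ?p' i k (halted \<sigma> (Q i)) \<le> 1 + ?p k (asking \<sigma> (D i))"
      by (rule prob_add_le_of_pmf_eq_outside)
    then show ?thesis by simp
  qed
  then have "ennreal (\<Sum>i\<in>I. ?p k (halted \<sigma> (P i)) + ?p' i k (halted \<sigma> (Q i)) - 1) \<le>
      ennreal (\<Sum>i\<in>I. ?p k (asking \<sigma> (D i)))" for k
    by (intro ennreal_leI sum_mono)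
  then show "\<exists>N. \<forall>k\<ge>N. ennreal (\<Sum>i\<in>I. ?p k (halted \<sigma> (P i)) + ?p' i k (halted \<sigma> (Q i)) - 1) \<le>
      of_nat d * expected_time G L \<sigma>"
    using sum_prob_asking_le_expected_time[OF \<open>finite I\<close> overlap] by (blast intro: order_trans)
qed

definition accurate :: "real \<Rightarrow> real \<Rightarrow> real \<Rightarrow> real \<Rightarrow> bool" where
  "accurate \<epsilon> \<delta> x y \<longleftrightarrow> \<bar>y - x\<bar> < \<epsilon> * max x \<delta>"

lemma output_prob_accurate_ge:
  assumes "solves_single_source \<alpha> \<epsilon> p\<^sub>f A"
    and "walk_graph G" "adj_lists_of G L" "s \<in> pverts G" "0 < \<delta>" "\<delta> \<le> 1" "t \<in> pverts G"
  shows "1 - p\<^sub>f \<le> output_prob G L (A (pverts G) s \<delta>) (\<lambda>e. accurate \<epsilon> \<delta> (ppr \<alpha> G s t) (e t))"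
  using assms unfolding solves_single_source_def accurate_def not_le[symmetric]
  by (simp only: diff_le_eq add.commute) blast

lemma expected_time_ge_of_ppr_gaps:
  fixes \<alpha> \<epsilon> \<delta> p\<^sub>f :: real
  assumes solver: "solves_single_source \<alpha> \<epsilon> p\<^sub>f A" and \<delta>: "0 < \<delta>" "\<delta> \<le> 1"
    and input: "walk_graph G" "adj_lists_of G L" "s \<in> pverts G"
    and inputs': "\<And>i. i \<in> I \<Longrightarrow> walk_graph (G' i)" "\<And>i. i \<in> I \<Longrightarrow> adj_lists_of (G' i) (L' i)"
      "\<And>i. i \<in> I \<Longrightarrow> pverts (G' i) = pverts G"
    and t: "\<And>i. i \<in> I \<Longrightarrow> t i \<in> pverts G"
    and gap: "\<And>i. i \<in> I \<Longrightarrow> ppr \<alpha> G s (t i) + \<epsilon> * max (ppr \<alpha> G s (t i)) \<delta> \<le>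
      ppr \<alpha> (G' i) s (t i) - \<epsilon> * max (ppr \<alpha> (G' i) s (t i)) \<delta>"
    and "finite I" and overlap: "\<And>q. card {i \<in> I. q \<in> D i} \<le> d"
    and same: "\<And>i q. i \<in> I \<Longrightarrow> q \<notin> D i \<Longrightarrow> reply (G' i) (L' i) q = reply G L q"
  shows "ennreal (card I * (1 - 2 * p\<^sub>f)) \<le> of_nat d * expected_time G L (A (pverts G) s \<delta>)"
proof -
  let ?\<sigma> = "A (pverts G) s \<delta>"
  let ?acc = "\<lambda>G i e. accurate \<epsilon> \<delta> (ppr \<alpha> G s (t i)) (e (t i))"
  have "1 - p\<^sub>f \<le> output_prob G L ?\<sigma> (?acc G i)" if "i \<in> I" for i
    using that by (intro output_prob_accurate_ge solver input \<delta> t)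
  moreover have "1 - p\<^sub>f \<le> output_prob (G' i) (L' i) ?\<sigma> (?acc (G' i) i)" if "i \<in> I" for i
    using that output_prob_accurate_ge[OF solver inputs'(1,2), of i s \<delta> "t i"]
      input(3) \<delta> inputs'(3) t by simp
  ultimately have sum: "(\<Sum>i\<in>I. 1 - 2 * p\<^sub>f) \<le>
      (\<Sum>i\<in>I. output_prob G L ?\<sigma> (?acc G i) + output_prob (G' i) (L' i) ?\<sigma> (?acc (G' i) i) - 1)"
    by (intro sum_mono) fastforce
  have incompatible: "\<not> (?acc G i e \<and> ?acc (G' i) i e)" if "i \<in> I" for i e
    using gap[OF that] unfolding accurate_def by linarith
  have "ennreal (card I * (1 - 2 * p\<^sub>f)) \<le> ennreal (\<Sum>i\<in>I. output_prob G L ?\<sigma> (?acc G i) +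
      output_prob (G' i) (L' i) ?\<sigma> (?acc (G' i) i) - 1)"
    using sum by (intro ennreal_leI) simp
  also have "\<dots> \<le> of_nat d * expected_time G L ?\<sigma>"
    by (rule sum_output_prob_le_expected_time[OF \<open>finite I\<close> overlap same incompatible])
  finally show ?thesis .
qed

lemma accurate_gap_of_zero:
  fixes \<delta> \<epsilon> x :: real
  assumes "0 \<le> \<epsilon>" "\<epsilon> < 1" "0 < \<delta>" and large: "\<delta> \<le> (1 - \<epsilon>) * x"
  shows "\<epsilon> * max 0 \<delta> \<le> x - \<epsilon> * max x \<delta>"
proof -
  have "0 < (1 - \<epsilon>) * x" using large \<open>0 < \<delta>\<close> by linarith
  then have "0 < x" using \<open>\<epsilon> < 1\<close> by (simp add: zero_less_mult_iff)
  then have "(1 - \<epsilon>) * x \<le> x" using \<open>0 \<le> \<epsilon>\<close> by (simp add: mult_le_cancel_right1)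
  with large have "max x \<delta> = x" by simp
  moreover have "\<epsilon> * \<delta> \<le> \<delta>" using assms(1-3) by simp
  with large have "\<epsilon> * \<delta> \<le> (1 - \<epsilon>) * x" by linarith
  ultimately show ?thesis using \<open>0 < \<delta>\<close> by (simp add: left_diff_distrib)
qed

section \<open>Digraphs without dead ends\<close>

lemma out_degree_eq_card_Image: "out_degree (with_proj G) x = card (parcs G `` {x})"
proof -
  have "out_arcs (with_proj G) x = Pair x ` (parcs G `` {x})"
    by (auto simp: out_arcs_def)
  then show ?thesis by (simp add: out_degree_def card_image inj_on_def)
qed

lemma in_degree_eq_card_Image: "in_degree (with_proj G) x = card ((parcs G)\<inverse> `` {x})"
proof -
  have "in_arcs (with_proj G) x = (\<lambda>y. (y, x)) ` ((parcs G)\<inverse> `` {x})"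
    by (auto simp: in_arcs_def)
  then show ?thesis by (simp add: in_degree_def card_image inj_on_def)
qed

lemma walk_graph_iff:
  "walk_graph G \<longleftrightarrow> finite (pverts G) \<and> parcs G \<subseteq> pverts G \<times> pverts G \<and>
     (\<forall>u\<in>pverts G. parcs G `` {u} \<noteq> {})"
proof -
  have "pair_fin_digraph G \<longleftrightarrow> finite (pverts G) \<and> parcs G \<subseteq> pverts G \<times> pverts G"
    using finite_subset[of "parcs G" "pverts G \<times> pverts G"]
    by (auto simp: pair_fin_digraph_def pair_fin_digraph_axioms_def pair_wf_digraph_def)
  moreover have "1 \<le> out_degree (with_proj G) u \<longleftrightarrow> parcs G `` {u} \<noteq> {}"
    if "finite (pverts G)" "parcs G \<subseteq> pverts G \<times> pverts G" for u
  proof -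
    have "parcs G `` {u} \<subseteq> pverts G" using that(2) by auto
    with that(1) have "finite (parcs G `` {u})" by (rule finite_subset[rotated])
    then show ?thesis
      unfolding out_degree_eq_card_Image by (metis One_nat_def Suc_le_eq card_gt_0_iff)
  qed
  ultimately show ?thesis
    unfolding walk_graph_def by blast
qed

lemma walk_graph_successors:
  assumes "walk_graph G" "u \<in> pverts G"
  shows "finite (parcs G `` {u})" "parcs G `` {u} \<noteq> {}"
  using assms by (auto simp: walk_graph_iff intro: finite_subset)

section \<open>Discounted random walks\<close>

lemma pmf_mult_le_pmf_bind: "pmf M x * pmf (f x) y \<le> pmf (bind_pmf M f) y"
proof -
  have "ennreal (pmf M x * pmf (f x) y) =
      (\<integral>\<^sup>+x'. ennreal (pmf (f x) y) * indicator {x} x' \<partial>measure_pmf M)"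
    by (simp add: nn_integral_cmult_indicator emeasure_pmf_single ennreal_mult' mult.commute)
  also have "\<dots> \<le> (\<integral>\<^sup>+x'. ennreal (pmf (f x') y) \<partial>measure_pmf M)"
    by (intro nn_integral_mono) (auto simp: indicator_def)
  also have "\<dots> = ennreal (pmf (bind_pmf M f) y)"
    by (rule ennreal_pmf_bind[symmetric])
  finally show ?thesis by simp
qed

lemma pmf_walk_step_At:
  assumes "0 \<le> \<alpha>" "\<alpha> \<le> 1" "walk_graph G" "(u, v) \<in> parcs G"
  shows "pmf (walk_step \<alpha> G (At u)) (At v) = (1 - \<alpha>) / out_degree (with_proj G) u"
proof -
  have "u \<in> pverts G" using assms(3,4) by (auto simp: walk_graph_iff)
  with assms(3) have "pmf (pmf_of_set (parcs G `` {u})) v = 1 / out_degree (with_proj G) u"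
    using assms(4) walk_graph_successors[of G u] by (simp add: out_degree_eq_card_Image)
  then have "pmf (map_pmf At (pmf_of_set (parcs G `` {u}))) (At v) = 1 / out_degree (with_proj G) u"
    by (simp add: pmf_map_inj' inj_def)
  then show ?thesis
    using assms(1,2) by (simp add: pmf_bind Image_singleton)
qed

lemma pmf_walk_step_Stopped:
  assumes "0 \<le> \<alpha>" "\<alpha> \<le> 1"
  shows "pmf (walk_step \<alpha> G (At u)) (Stopped u) = \<alpha>"
proof -
  have "pmf (map_pmf At p) (Stopped u) = 0" for p
    by (rule pmf_map_outside) auto
  then show ?thesis using assms by (simp add: pmf_bind)
qed

lemma pmf_walk_after_path_ge:
  assumes \<alpha>: "0 \<le> \<alpha>" "\<alpha> \<le> 1" and G: "walk_graph G"
    and path: "\<And>i. i < k \<Longrightarrow> (w i, w (Suc i)) \<in> parcs G"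
  shows "(\<Prod>i<k. (1 - \<alpha>) / out_degree (with_proj G) (w i)) \<le> pmf (walk_after \<alpha> G (w 0) k) (At (w k))"
  using path
proof (induction k)
  case (Suc k)
  have "(\<Prod>i<Suc k. (1 - \<alpha>) / out_degree (with_proj G) (w i)) =
      (\<Prod>i<k. (1 - \<alpha>) / out_degree (with_proj G) (w i)) *
      pmf (walk_step \<alpha> G (At (w k))) (At (w (Suc k)))"
    using pmf_walk_step_At[OF \<alpha> G] Suc.prems by simp
  also have "\<dots> \<le> pmf (walk_after \<alpha> G (w 0) k) (At (w k)) *
      pmf (walk_step \<alpha> G (At (w k))) (At (w (Suc k)))"
    using Suc by (intro mult_right_mono) auto
  also have "\<dots> \<le> pmf (walk_after \<alpha> G (w 0) (Suc k)) (At (w (Suc k)))"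
    by (simp only: walk_after.simps pmf_mult_le_pmf_bind)
  finally show ?case .
qed simp

lemma pmf_Stopped_le_ppr: "pmf (walk_after \<alpha> G s k) (Stopped t) \<le> ppr \<alpha> G s t"
  unfolding ppr_def by (intro cSUP_upper bdd_aboveI[of _ 1]) (auto simp: pmf_le_1)

lemma ppr_path_ge:
  assumes \<alpha>: "0 \<le> \<alpha>" "\<alpha> \<le> 1" and "walk_graph G"
    and "\<And>i. i < k \<Longrightarrow> (w i, w (Suc i)) \<in> parcs G"
  shows "(\<Prod>i<k. (1 - \<alpha>) / out_degree (with_proj G) (w i)) * \<alpha> \<le> ppr \<alpha> G (w 0) (w k)"
proof -
  have "(\<Prod>i<k. (1 - \<alpha>) / out_degree (with_proj G) (w i)) * \<alpha> \<le>
      pmf (walk_after \<alpha> G (w 0) k) (At (w k)) * pmf (walk_step \<alpha> G (At (w k))) (Stopped (w k))"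
    unfolding pmf_walk_step_Stopped[OF \<alpha>]
    using \<alpha> by (intro mult_right_mono pmf_walk_after_path_ge assms)
  also have "\<dots> \<le> pmf (walk_after \<alpha> G (w 0) (Suc k)) (Stopped (w k))"
    by (simp only: walk_after.simps pmf_mult_le_pmf_bind)
  also have "\<dots> \<le> ppr \<alpha> G (w 0) (w k)"
    by (rule pmf_Stopped_le_ppr)
  finally show ?thesis .
qed

lemma ppr_eq_0_if_unreachable:
  assumes G: "walk_graph G" and "s \<in> pverts G" and unreachable: "(s, t) \<notin> (parcs G)\<^sup>*"
  shows "ppr \<alpha> G s t = 0"
proof -
  define C where "C = pverts G \<inter> (parcs G)\<^sup>* `` {s}"
  have step: "set_pmf (walk_step \<alpha> G st) \<subseteq> At ` C \<union> Stopped ` C"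
    if st: "st \<in> At ` C \<union> Stopped ` C" for st
  proof (cases st)
    case (At u)
    with st have "u \<in> C" by auto
    then have "v \<in> C" if "(u, v) \<in> parcs G" for v
      using G that by (auto simp: C_def walk_graph_iff intro: rtrancl_into_rtrancl)
    moreover have "set_pmf (pmf_of_set {v. (u, v) \<in> parcs G}) = parcs G `` {u}"
      using \<open>u \<in> C\<close> walk_graph_successors[OF G, of u]
      by (simp add: C_def set_pmf_of_set Image_singleton)
    ultimately show ?thesis
      using At \<open>u \<in> C\<close> by (auto split: if_splits)
  qed (use st in auto)
  have "set_pmf (walk_after \<alpha> G s k) \<subseteq> At ` C \<union> Stopped ` C" for k
  proof (induction k)
    case 0
    then show ?case using \<open>s \<in> pverts G\<close> by (simp add: C_def)
  next
    case (Suc k)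
    then show ?case using step unfolding walk_after.simps set_bind_pmf by blast
  qed
  moreover have "t \<notin> C" using unreachable by (simp add: C_def)
  ultimately have "pmf (walk_after \<alpha> G s k) (Stopped t) = 0" for k
    by (fastforce simp: pmf_eq_0_set_pmf)
  then show ?thesis by (simp add: ppr_def)
qed

section \<open>Two-lifts of a digraph\<close>

definition copy :: "nat \<Rightarrow> bool \<Rightarrow> nat" where
  "copy k b = 2 * k + of_bool b"

lemma copy_div_2 [simp]: "copy k b div 2 = k"
  by (cases b) (simp_all add: copy_def)

lemma even_copy_iff [simp]: "even (copy k b) \<longleftrightarrow> \<not> b"
  by (cases b) (simp_all add: copy_def)

lemma copy_eq_iff [simp]: "copy k b = x \<longleftrightarrow> k = x div 2 \<and> (b \<longleftrightarrow> odd x)"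
  by (cases b) (auto simp: copy_def)

text \<open>
  Node \<open>k\<close> of the base digraph has the two copies \<open>2 * k\<close> and \<open>2 * k + 1\<close>. The copies of
  a base arc in \<open>F\<close> cross between the two sheets, those of any other base arc stay within a sheet.
\<close>

definition lift_arcs :: "nat rel \<Rightarrow> nat rel \<Rightarrow> nat rel" where
  "lift_arcs B F = {(x, y). (x div 2, y div 2) \<in> B \<and>
     (odd x = odd y \<longleftrightarrow> (x div 2, y div 2) \<notin> F)}"

definition lift :: "nat pair_pre_digraph \<Rightarrow> nat rel \<Rightarrow> nat pair_pre_digraph" where
  "lift H F = \<lparr>pverts = {x. x div 2 \<in> pverts H}, parcs = lift_arcs (parcs H) F\<rparr>"

lemma lift_simps [simp]:
  "pverts (lift H F) = {x. x div 2 \<in> pverts H}" "parcs (lift H F) = lift_arcs (parcs H) F"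
  by (simp_all add: lift_def)

lemma converse_lift_arcs: "(lift_arcs B F)\<inverse> = lift_arcs (B\<inverse>) (F\<inverse>)"
  by (auto simp: lift_arcs_def)

lemma bij_betw_pverts_lift:
  "bij_betw (\<lambda>(k, b). copy k b) (pverts H \<times> UNIV) (pverts (lift H F))"
  by (rule bij_betw_byWitness[where f' = "\<lambda>x. (x div 2, odd x)"]) auto

lemma bij_betw_lift_arcs:
  "bij_betw (\<lambda>((u, v), b). (copy u b, copy v (b = ((u, v) \<notin> F)))) (B \<times> UNIV) (lift_arcs B F)"
  by (rule bij_betw_byWitness[where f' = "\<lambda>(x, y). ((x div 2, y div 2), odd x)"])
    (auto simp: lift_arcs_def)

lemma bij_betw_successors_lift:
  "bij_betw (\<lambda>v. copy v (odd x = ((x div 2, v) \<notin> F))) (B `` {x div 2}) (lift_arcs B F `` {x})"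
  by (rule bij_betw_byWitness[where f' = "\<lambda>y. y div 2"]) (auto simp: lift_arcs_def)

lemma card_pverts_lift: "card (pverts (lift H F)) = 2 * card (pverts H)"
  using bij_betw_same_card[OF bij_betw_pverts_lift[of H F]] by (simp add: card_cartesian_product)

lemma card_parcs_lift: "card (parcs (lift H F)) = 2 * card (parcs H)"
  using bij_betw_same_card[OF bij_betw_lift_arcs[of F "parcs H"]]
  by (simp add: card_cartesian_product)

lemma out_degree_lift: "out_degree (with_proj (lift H F)) x = out_degree (with_proj H) (x div 2)"
  using bij_betw_same_card[OF bij_betw_successors_lift] by (simp add: out_degree_eq_card_Image)

lemma in_degree_lift: "in_degree (with_proj (lift H F)) x = in_degree (with_proj H) (x div 2)"
  using bij_betw_same_card[OF bij_betw_successors_lift]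
  by (simp add: in_degree_eq_card_Image converse_lift_arcs)

lemma walk_graph_lift:
  assumes "walk_graph H"
  shows "walk_graph (lift H F)"
  unfolding walk_graph_iff
proof (intro conjI ballI)
  show "finite (pverts (lift H F))"
    using bij_betw_finite[OF bij_betw_pverts_lift[of H F]] assms by (simp add: walk_graph_iff)
  show "parcs (lift H F) \<subseteq> pverts (lift H F) \<times> pverts (lift H F)"
    using assms by (auto simp: walk_graph_iff lift_arcs_def)
  show "parcs (lift H F) `` {x} \<noteq> {}" if "x \<in> pverts (lift H F)" for x
    using that assms bij_betw_imp_surj_on[OF bij_betw_successors_lift, of x F "parcs H"]
    by (auto simp: walk_graph_iff)
qed

lemma same_sheet_if_reachable_lift:
  assumes "(x, y) \<in> (parcs (lift H {}))\<^sup>*"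
  shows "odd x \<longleftrightarrow> odd y"
  using assms by (induction rule: rtrancl_induct) (auto simp: lift_arcs_def)

lemma ppr_lift_other_sheet_eq_0:
  assumes "walk_graph H" "s div 2 \<in> pverts H" "odd s \<noteq> odd t"
  shows "ppr \<alpha> (lift H {}) s t = 0"
  using assms same_sheet_if_reachable_lift[of s t H]
  by (intro ppr_eq_0_if_unreachable walk_graph_lift) auto

lemma ppr_lift_crossed_arc_ge:
  assumes "0 \<le> \<alpha>" "\<alpha> \<le> 1" "walk_graph H"
    and "(r, u) \<in> parcs H" "(u, v) \<in> parcs H" "r \<noteq> u"
  shows "\<alpha> * (1 - \<alpha>)\<^sup>2 / (out_degree (with_proj H) r * out_degree (with_proj H) u) \<le>
    ppr \<alpha> (lift H {(u, v)}) (copy r False) (copy v True)"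
proof -
  define w where "w = (!) [copy r False, copy u False, copy v True]"
  have "(w i, w (Suc i)) \<in> parcs (lift H {(u, v)})" if "i < 2" for i
    using that assms(4-6) by (auto simp: w_def lift_arcs_def less_2_cases_iff)
  from ppr_path_ge[of _ _ 2 w, OF assms(1,2) walk_graph_lift[OF assms(3)] this]
  have "(\<Prod>i\<in>{0, 1}. (1 - \<alpha>) / out_degree (with_proj H) (w i div 2)) * \<alpha> \<le>
      ppr \<alpha> (lift H {(u, v)}) (w 0) (w 2)"
    by (simp add: out_degree_lift lessThan_nat_numeral lessThan_Suc insert_commute)
  then show ?thesis
    by (simp add: w_def power2_eq_square mult_ac)
qed

section \<open>Queries to a lift\<close>

definition flip :: "nat rel \<Rightarrow> nat \<Rightarrow> nat \<Rightarrow> nat" where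
  "flip F x y = (if (x div 2, y div 2) \<in> F then copy (y div 2) (even y) else y)"

lemma flip_div_2 [simp]: "flip F x y div 2 = y div 2"
  by (simp add: flip_def)

lemma flip_flip [simp]: "flip F x (flip F x y) = y"
  by (simp add: flip_def)

lemma inj_on_flip: "inj_on (flip F x) A"
  by (metis flip_flip inj_on_inverseI)

lemma flip_image_successors_lift: "flip F x ` (lift_arcs B {} `` {x}) = lift_arcs B F `` {x}"
proof (intro equalityI subsetI)
  fix y assume "y \<in> lift_arcs B F `` {x}"
  then have "flip F x y \<in> lift_arcs B {} `` {x}" by (auto simp: flip_def lift_arcs_def)
  then show "y \<in> flip F x ` (lift_arcs B {} `` {x})" by (metis flip_flip imageI)
qed (auto simp: flip_def lift_arcs_def)

lemma flip_image_predecessors_lift: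
  "flip (F\<inverse>) x ` ((lift_arcs B {})\<inverse> `` {x}) = (lift_arcs B F)\<inverse> `` {x}"
  by (simp add: converse_lift_arcs flip_image_successors_lift)

definition flip_lists :: "nat rel \<Rightarrow> adj_lists \<Rightarrow> adj_lists" where
  "flip_lists F L = \<lparr>in_list = (\<lambda>x. map (flip (F\<inverse>) x) (in_list L x)),
     out_list = (\<lambda>x. map (flip F x) (out_list L x)),
     sorted_in_list = (\<lambda>x. map (flip (F\<inverse>) x) (sorted_in_list L x))\<rparr>"

lemma adj_lists_of_iff:
  "adj_lists_of G L \<longleftrightarrow> (\<forall>u\<in>pverts G.
     distinct (in_list L u) \<and> set (in_list L u) = (parcs G)\<inverse> `` {u} \<and>
     distinct (out_list L u) \<and> set (out_list L u) = parcs G `` {u} \<and>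
     distinct (sorted_in_list L u) \<and> set (sorted_in_list L u) = (parcs G)\<inverse> `` {u} \<and>
     sorted (map (out_degree (with_proj G)) (sorted_in_list L u)))"
  by (simp add: adj_lists_of_def Image_singleton)

lemma adj_lists_of_flip_lists:
  assumes "adj_lists_of (lift H {}) L"
  shows "adj_lists_of (lift H F) (flip_lists F L)"
proof -
  have "out_degree (with_proj (lift H F')) = (\<lambda>x. out_degree (with_proj H) (x div 2))" for F'
    by (rule ext) (rule out_degree_lift)
  then show ?thesis
    using assms
    by (simp add: adj_lists_of_iff flip_lists_def distinct_map inj_on_flip o_def
        flip_image_successors_lift flip_image_predecessors_lift)
qed

text \<open>
  An index out of range yields an arbitrary arc here, which is harmless because the reply is then
  \<open>Invalid\<close> on every lift.
\<close>

fun revealed_arcs :: "adj_lists \<Rightarrow> query \<Rightarrow> nat rel" where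
  "revealed_arcs L (IN x k) = {(in_list L x ! k div 2, x div 2)}"
| "revealed_arcs L (OUT x k) = {(x div 2, out_list L x ! k div 2)}"
| "revealed_arcs L (ADJ x y) = {(x div 2, y div 2)}"
| "revealed_arcs L (IN_SORTED x k) = {(sorted_in_list L x ! k div 2, x div 2)}"
| "revealed_arcs L _ = {}"

lemma finite_revealed_arcs: "finite (revealed_arcs L q)"
  by (cases q) simp_all

lemma card_revealed_arcs_le_1: "card (revealed_arcs L q) \<le> 1"
  by (cases q) simp_all

lemma reply_flip_lists:
  assumes "F \<inter> revealed_arcs L q = {}"
  shows "reply (lift H F) (flip_lists F L) q = reply (lift H {}) L q"
  using assms
  by (cases q)
    (auto simp: in_degree_lift out_degree_lift entry_def flip_lists_def flip_def lift_arcs_def)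

lemma expected_time_lift_ge:
  fixes \<alpha> \<epsilon> \<delta> p\<^sub>f :: real
  assumes solver: "solves_single_source \<alpha> \<epsilon> p\<^sub>f A"
    and \<delta>: "0 < \<delta>" "\<delta> \<le> 1" and \<epsilon>: "0 \<le> \<epsilon>" "\<epsilon> < 1"
    and base: "walk_graph H" "s \<in> pverts H" "E \<subseteq> parcs H" and lists: "adj_lists_of (lift H {}) L"
    and large: "\<And>u v. (u, v) \<in> E \<Longrightarrow>
      \<delta> \<le> (1 - \<epsilon>) * ppr \<alpha> (lift H {(u, v)}) (copy s False) (copy v True)"
  shows "ennreal (card E * (1 - 2 * p\<^sub>f)) \<le>
    expected_time (lift H {}) L (A (pverts (lift H {})) (copy s False) \<delta>)"
proof -
  let ?s = "copy s False" and ?t = "\<lambda>e :: nat \<times> nat. copy (snd e) True"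
  have uncrossed: "ppr \<alpha> (lift H {}) ?s (?t e) = 0" for e
    using base(1,2) by (intro ppr_lift_other_sheet_eq_0) auto
  have gap: "ppr \<alpha> (lift H {}) ?s (?t e) + \<epsilon> * max (ppr \<alpha> (lift H {}) ?s (?t e)) \<delta> \<le>
      ppr \<alpha> (lift H {e}) ?s (?t e) - \<epsilon> * max (ppr \<alpha> (lift H {e}) ?s (?t e)) \<delta>"
    if "e \<in> E" for e
    using accurate_gap_of_zero[OF \<epsilon> \<delta>(1) large[of "fst e" "snd e"]] that by (simp add: uncrossed)
  have "E \<subseteq> pverts H \<times> pverts H" and "finite (pverts H)"
    using base by (auto simp: walk_graph_iff)
  then have finite_E: "finite E" and snd_E: "e \<in> E \<Longrightarrow> snd e \<in> pverts H" for e
    by (auto intro: finite_subset)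
  have overlap: "card {e \<in> E. e \<in> revealed_arcs L q} \<le> 1" for q
    by (rule order_trans[OF card_mono[OF finite_revealed_arcs] card_revealed_arcs_le_1]) auto
  have "ennreal (card E * (1 - 2 * p\<^sub>f)) \<le>
      of_nat 1 * expected_time (lift H {}) L (A (pverts (lift H {})) ?s \<delta>)"
    by (rule expected_time_ge_of_ppr_gaps[OF solver \<delta> walk_graph_lift[OF base(1)] lists _
          walk_graph_lift[OF base(1)] adj_lists_of_flip_lists[OF lists] _ _ gap finite_E,
          where D = "\<lambda>e. {q. e \<in> revealed_arcs L q}"])
      (use base(2) snd_E overlap reply_flip_lists in auto)
  then show ?thesis by simp
qed

section \<open>Two layers of critical arcs\<close>

definition two_layers :: "'a pair_pre_digraph \<Rightarrow> 'a \<Rightarrow> 'a set \<Rightarrow> 'a set \<Rightarrow> bool" where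
  "two_layers H s X Y \<longleftrightarrow> parcs H `` {s} = X \<and> s \<notin> X \<and> (\<forall>u\<in>X. parcs H `` {u} = Y)"

lemma two_layers_card_pos:
  assumes "walk_graph H" "s \<in> pverts H" "two_layers H s X Y"
  shows "0 < card X" "0 < card Y"
proof -
  have X: "parcs H `` {s} = X" and Y: "\<And>u. u \<in> X \<Longrightarrow> parcs H `` {u} = Y"
    using assms(3) by (auto simp: two_layers_def)
  from walk_graph_successors[OF assms(1,2)] show "0 < card X"
    by (simp add: X card_gt_0_iff)
  then obtain u where u: "u \<in> X" by fastforce
  with X assms(1) have "u \<in> pverts H" by (auto simp: walk_graph_iff)
  from walk_graph_successors[OF assms(1) this] show "0 < card Y"
    by (simp add: Y[OF u] card_gt_0_iff)
qed

lemma ppr_lift_two_layers_ge: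
  assumes "0 \<le> \<alpha>" "\<alpha> \<le> 1" "walk_graph H" "two_layers H s X Y" "u \<in> X" "v \<in> Y"
  shows "\<alpha> * (1 - \<alpha>)\<^sup>2 / real (card X * card Y) \<le>
    ppr \<alpha> (lift H {(u, v)}) (copy s False) (copy v True)"
proof -
  have X: "parcs H `` {s} = X" and Y: "parcs H `` {u} = Y" and "s \<noteq> u"
    using assms(4,5) by (auto simp: two_layers_def)
  then have "(s, u) \<in> parcs H" "(u, v) \<in> parcs H" using assms(5,6) by auto
  from ppr_lift_crossed_arc_ge[OF assms(1-3) this \<open>s \<noteq> u\<close>] show ?thesis
    by (simp add: out_degree_eq_card_Image X Y)
qed

lemma expected_time_lift_two_layers_ge:
  fixes \<alpha> \<epsilon> \<delta> p\<^sub>f :: real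
  assumes solver: "solves_single_source \<alpha> \<epsilon> p\<^sub>f A"
    and \<alpha>: "0 \<le> \<alpha>" "\<alpha> \<le> 1" and \<epsilon>: "0 \<le> \<epsilon>" "\<epsilon> < 1" and p\<^sub>f: "0 \<le> p\<^sub>f" "p\<^sub>f \<le> 1 / 2"
    and \<delta>: "0 < \<delta>" "\<delta> \<le> 1"
    and base: "walk_graph H" "s \<in> pverts H" and layers: "two_layers H s X Y"
    and lists: "adj_lists_of (lift H {}) L"
    and few_arcs: "real (card X * card Y) \<le> max 1 (\<alpha> * (1 - \<alpha>)\<^sup>2 * (1 - \<epsilon>) / \<delta>)"
  shows "ennreal (real (card X * card Y) * (1 - 2 * p\<^sub>f)) \<le>
    expected_time (lift H {}) L (A (pverts (lift H {})) (copy s False) \<delta>)"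
proof (cases "real (card X * card Y) \<le> \<alpha> * (1 - \<alpha>)\<^sup>2 * (1 - \<epsilon>) / \<delta>")
  case True
  have "\<delta> \<le> (1 - \<epsilon>) * ppr \<alpha> (lift H {(u, v)}) (copy s False) (copy v True)"
    if "(u, v) \<in> X \<times> Y" for u v
  proof -
    have "\<delta> \<le> (1 - \<epsilon>) * (\<alpha> * (1 - \<alpha>)\<^sup>2 / real (card X * card Y))"
      using True \<delta>(1) two_layers_card_pos[OF base layers] by (simp add: pos_le_divide_eq mult_ac)
    also have "\<dots> \<le> (1 - \<epsilon>) * ppr \<alpha> (lift H {(u, v)}) (copy s False) (copy v True)"
      using \<epsilon> that by (intro mult_left_mono ppr_lift_two_layers_ge[OF \<alpha> base(1) layers]) auto
    finally show ?thesis .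
  qed
  moreover have "X \<times> Y \<subseteq> parcs H" using layers by (auto simp: two_layers_def)
  ultimately have "ennreal (card (X \<times> Y) * (1 - 2 * p\<^sub>f)) \<le>
      expected_time (lift H {}) L (A (pverts (lift H {})) (copy s False) \<delta>)"
    using lists by (intro expected_time_lift_ge[OF solver \<delta> \<epsilon> base]) auto
  then show ?thesis by (simp add: card_cartesian_product)
next
  case False
  with few_arcs have "real (card X * card Y) \<le> 1" by (simp add: le_max_iff_disj)
  then have "real (card X * card Y) * (1 - 2 * p\<^sub>f) \<le> 1 * 1" using p\<^sub>f by (intro mult_mono) auto
  then have "ennreal (real (card X * card Y) * (1 - 2 * p\<^sub>f)) \<le> 1" by (simp add: ennreal_le_1)
  then show ?thesis using one_le_expected_time by (rule order_trans)
qed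

text \<open>
  Here \<open>R\<close> pads the digraph to the required number of arcs and lets a walk move on from the
  second layer.
\<close>

definition two_layer_digraph :: "nat \<Rightarrow> nat \<Rightarrow> nat \<Rightarrow> nat rel \<Rightarrow> nat pair_pre_digraph" where
  "two_layer_digraph p q n R = \<lparr>pverts = {..p + n},
     parcs = {0} \<times> {1..p} \<union> {1..p} \<times> {p + 1..p + q} \<union> R\<rparr>"

lemma walk_graph_two_layer_digraph:
  assumes "1 \<le> p" "1 \<le> q" "q \<le> n"
    and "Id_on {p + 1..p + n} \<subseteq> R" "R \<subseteq> {p + 1..p + n} \<times> {p + 1..p + n}"
  shows "walk_graph (two_layer_digraph p q n R)"
  unfolding walk_graph_iff
proof (intro conjI ballI)
  show "parcs (two_layer_digraph p q n R) `` {u} \<noteq> {}"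
    if "u \<in> pverts (two_layer_digraph p q n R)" for u
  proof -
    have "u \<le> p + n" using that by (simp add: two_layer_digraph_def)
    then consider "u = 0" | "1 \<le> u" "u \<le> p" | "p + 1 \<le> u" "u \<le> p + n" by linarith
    then show ?thesis
      using assms by cases (force simp: two_layer_digraph_def)+
  qed
qed (use assms in \<open>auto simp: two_layer_digraph_def\<close>)

lemma two_layers_two_layer_digraph:
  assumes "R \<subseteq> {p + 1..p + n} \<times> {p + 1..p + n}"
  shows "two_layers (two_layer_digraph p q n R) 0 {1..p} {p + 1..p + q}"
  using assms by (auto simp: two_layers_def two_layer_digraph_def)

lemma card_parcs_two_layer_digraph:
  assumes "R \<subseteq> {p + 1..p + n} \<times> {p + 1..p + n}"
  shows "card (parcs (two_layer_digraph p q n R)) = p + p * q + card R"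
proof -
  have "finite R" using assms by (rule finite_subset) simp
  then have "card (parcs (two_layer_digraph p q n R)) =
      card ({0::nat} \<times> {1..p} \<union> {1..p} \<times> {p + 1..p + q}) + card R"
    using assms unfolding two_layer_digraph_def pair_pre_digraph.simps
    by (intro card_Un_disjoint) auto
  also have "card ({0::nat} \<times> {1..p} \<union> {1..p} \<times> {p + 1..p + q}) = p + p * q"
    by (subst card_Un_disjoint) (auto simp: card_cartesian_product)
  finally show ?thesis .
qed

lemma exists_reflexive_rel_card:
  assumes "finite P" "card P \<le> m" "m \<le> (card P)\<^sup>2"
  obtains R where "Id_on P \<subseteq> R" "R \<subseteq> P \<times> P" "card R = m"
proof -
  have "Id_on P = (\<lambda>x. (x, x)) ` P" by auto
  then have "card (Id_on P) = card P" by (simp add: card_image inj_on_def)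
  with assms that show thesis
    using exists_subset_between[of "Id_on P" m "P \<times> P"]
    by (auto simp: card_cartesian_product power2_eq_square)
qed

lemma exists_rectangle_of_area:
  fixes n :: nat and x :: real
  assumes "1 \<le> n" "x \<le> (real n)\<^sup>2"
  obtains p q :: nat where "1 \<le> p" "p \<le> n" "1 \<le> q" "q \<le> n"
    "real (p * q) \<le> max 1 x" "x \<le> 2 * real (p * q)"
proof -
  have floor: "1 \<le> nat \<lfloor>y\<rfloor>" "real (nat \<lfloor>y\<rfloor>) \<le> y" "y \<le> 2 * real (nat \<lfloor>y\<rfloor>)"
    if "1 \<le> y" for y :: real
  proof -
    show floor_pos: "1 \<le> nat \<lfloor>y\<rfloor>" and "real (nat \<lfloor>y\<rfloor>) \<le> y" using that by linarith+
    have "y < real (nat \<lfloor>y\<rfloor>) + 1" using that by linarith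
    with floor_pos show "y \<le> 2 * real (nat \<lfloor>y\<rfloor>)" by linarith
  qed
  consider (unit) "x < 1" | (row) "1 \<le> x" "x \<le> n" | (rows) "n < x" by linarith
  then show thesis
  proof cases
    case unit
    then show thesis using assms(1) by (intro that[of 1 1]) auto
  next
    case row
    then have "nat \<lfloor>x\<rfloor> \<le> n" by linarith
    with floor[OF row(1)] show thesis
      using assms(1) by (intro that[of "nat \<lfloor>x\<rfloor>" 1]) auto
  next
    case rows
    define q where "q = nat \<lfloor>x / n\<rfloor>"
    have "1 \<le> x / n" "x / n \<le> n"
      using rows assms by (simp_all add: divide_le_eq power2_eq_square)
    then have q: "1 \<le> q" "q \<le> n" "q \<le> x / n" "x / n \<le> 2 * real q"
      using floor[of "x / n"] by (auto simp: q_def) linarith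
    then have "real (n * q) \<le> x" "x \<le> 2 * real (n * q)"
      using assms(1) by (simp_all add: field_simps)
    then show thesis using assms(1) q(1,2) by (intro that[of n q]) auto
  qed
qed

lemma exists_two_layers:
  assumes "1 \<le> p" "p \<le> n" "1 \<le> q" "q \<le> n" "n \<le> m" "m \<le> n\<^sup>2"
  obtains H s X Y where "walk_graph H" "s \<in> pverts H" "two_layers H s X Y" "card X = p" "card Y = q"
    "card (pverts H) = p + n + 1" "card (parcs H) = p + p * q + m"
proof -
  obtain R where R: "Id_on {p + 1..p + n} \<subseteq> R" "R \<subseteq> {p + 1..p + n} \<times> {p + 1..p + n}"
      "card R = m"
    using exists_reflexive_rel_card[of "{p + 1..p + n}" m] assms(5,6) by auto
  show thesis
  proof (rule that)
    show "walk_graph (two_layer_digraph p q n R)"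
      by (rule walk_graph_two_layer_digraph[OF assms(1,3,4) R(1,2)])
    show "two_layers (two_layer_digraph p q n R) 0 {1..p} {p + 1..p + q}"
      by (rule two_layers_two_layer_digraph[OF R(2)])
    show "card (parcs (two_layer_digraph p q n R)) = p + p * q + m"
      unfolding card_parcs_two_layer_digraph[OF R(2)] R(3) ..
  qed (simp_all add: two_layer_digraph_def)
qed

lemma scaled_min_le_of_min_scaled_le:
  fixes a b c \<eta> K :: real
  assumes "0 \<le> c" "c \<le> 1" "0 \<le> a" "0 \<le> \<eta>" "min a (c * b) \<le> 2 * K"
  shows "c * \<eta> / 2 * min a b \<le> K * \<eta>"
proof -
  have "c * min a b = min (c * a) (c * b)"
    using assms(1) by (simp add: min_mult_distrib_left)
  also have "\<dots> \<le> min a (c * b)"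
    using assms(1-3) by (intro min.mono) (auto intro: mult_left_le_one_le)
  also have "\<dots> \<le> 2 * K" by fact
  finally have "c * min a b * \<eta> \<le> 2 * K * \<eta>"
    using assms(4) by (rule mult_right_mono)
  then show ?thesis by (simp add: mult_ac)
qed

lemma exists_hard_input:
  fixes \<alpha> \<epsilon> \<delta> p\<^sub>f :: real and n m :: nat
  assumes \<alpha>: "0 \<le> \<alpha>" "\<alpha> \<le> 1" and \<epsilon>: "0 \<le> \<epsilon>" "\<epsilon> < 1" and p\<^sub>f: "0 \<le> p\<^sub>f" "p\<^sub>f \<le> 1 / 2"
    and nm: "1 \<le> n" "n \<le> m" "m \<le> n\<^sup>2" and \<delta>: "0 < \<delta>" "\<delta> \<le> 1"
  shows "\<exists>G s. walk_graph G \<and> s \<in> pverts G \<and>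
    2 * real n \<le> real (card (pverts G)) \<and> real (card (pverts G)) \<le> 6 * real n \<and>
    2 * real m \<le> real (card (parcs G)) \<and> real (card (parcs G)) \<le> 6 * real m \<and>
    (\<forall>A L. solves_single_source \<alpha> \<epsilon> p\<^sub>f A \<and> adj_lists_of G L \<longrightarrow>
       ennreal (\<alpha> * (1 - \<alpha>)\<^sup>2 * (1 - \<epsilon>) * (1 - 2 * p\<^sub>f) / 2 * min (real m) (1 / \<delta>))
         \<le> expected_time G L (A (pverts G) s \<delta>))"
proof -
  define C where "C = \<alpha> * (1 - \<alpha>)\<^sup>2 * (1 - \<epsilon>)"
  have C_bounds: "0 \<le> C" "C \<le> 1"
    unfolding C_def using \<alpha> \<epsilon> by (auto intro!: mult_nonneg_nonneg mult_le_one power_le_one)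
  have "min m (C / \<delta>) \<le> (real n)\<^sup>2"
    using nm(3) by (simp add: min_le_iff_disj flip: of_nat_power)
  with nm(1) obtain p q where pq: "1 \<le> p" "p \<le> n" "1 \<le> q" "q \<le> n"
      "real (p * q) \<le> max 1 (min m (C / \<delta>))" "min m (C / \<delta>) \<le> 2 * real (p * q)"
    by (rule exists_rectangle_of_area)
  obtain H s X Y where H: "walk_graph H" "s \<in> pverts H" "two_layers H s X Y"
      "card X = p" "card Y = q" "card (pverts H) = p + n + 1" "card (parcs H) = p + p * q + m"
    using exists_two_layers[OF pq(1-4) nm(2,3)] .
  have few_arcs: "p + real (p * q) \<le> 2 * real m"
    using pq(2,5) nm(1,2) by linarith
  have time: "ennreal (C * (1 - 2 * p\<^sub>f) / 2 * min m (1 / \<delta>)) \<le>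
      expected_time (lift H {}) L (A (pverts (lift H {})) (copy s False) \<delta>)"
    if "solves_single_source \<alpha> \<epsilon> p\<^sub>f A" "adj_lists_of (lift H {}) L" for A L
  proof -
    have "C * (1 - 2 * p\<^sub>f) / 2 * min m (1 / \<delta>) \<le> real (card X * card Y) * (1 - 2 * p\<^sub>f)"
      using C_bounds p\<^sub>f pq(6) by (intro scaled_min_le_of_min_scaled_le) (simp_all add: H(4,5))
    then have "ennreal (C * (1 - 2 * p\<^sub>f) / 2 * min m (1 / \<delta>)) \<le>
        ennreal (real (card X * card Y) * (1 - 2 * p\<^sub>f))"
      by (rule ennreal_leI)
    also have "\<dots> \<le> expected_time (lift H {}) L (A (pverts (lift H {})) (copy s False) \<delta>)"
      using pq(5) that unfolding C_def
      by (intro expected_time_lift_two_layers_ge[OF _ \<alpha> \<epsilon> p\<^sub>f \<delta> H(1-3)]) (auto simp: H(4,5))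
    finally show ?thesis .
  qed
  show ?thesis
  proof (intro exI[of _ "lift H {}"] exI[of _ "copy s False"] conjI allI impI)
    show "walk_graph (lift H {})" by (rule walk_graph_lift[OF H(1)])
    show "copy s False \<in> pverts (lift H {})" using H(2) by simp
    show "2 * real n \<le> card (pverts (lift H {}))" "card (pverts (lift H {})) \<le> 6 * real n"
      unfolding card_pverts_lift H(6) using pq(2) nm(1) by simp_all
    show "2 * real m \<le> card (parcs (lift H {}))" "card (parcs (lift H {})) \<le> 6 * real m"
      unfolding card_parcs_lift H(7) using few_arcs by simp_all
  qed (use time in \<open>auto simp: C_def\<close>)
qed

theorem theorem4p1:
  fixes \<alpha> \<epsilon> p\<^sub>f :: real
  assumes "0 < \<alpha>" "\<alpha> < 1" and "0 < \<epsilon>" "\<epsilon> < 1" and "0 < p\<^sub>f" "p\<^sub>f < 1 / 2"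
  shows "\<exists>a\<^sub>1 a\<^sub>2 b\<^sub>1 b\<^sub>2 c :: real. 0 < a\<^sub>1 \<and> 0 < a\<^sub>2 \<and> 0 < b\<^sub>1 \<and> 0 < b\<^sub>2 \<and> 0 < c \<and>
    (\<forall>(n::nat) (m::nat) (\<delta>::real).
       1 \<le> n \<and> n \<le> m \<and> m \<le> n\<^sup>2 \<and> 0 < \<delta> \<and> \<delta> \<le> 1 \<longrightarrow>
       (\<exists>G s. walk_graph G \<and> s \<in> pverts G \<and>
          a\<^sub>1 * real n \<le> real (card (pverts G)) \<and> real (card (pverts G)) \<le> a\<^sub>2 * real n \<and>
          b\<^sub>1 * real m \<le> real (card (parcs G)) \<and> real (card (parcs G)) \<le> b\<^sub>2 * real m \<and>
          (\<forall>A L. solves_single_source \<alpha> \<epsilon> p\<^sub>f A \<and> adj_lists_of G L \<longrightarrow>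
             ennreal (c * min (real m) (1 / \<delta>))
               \<le> expected_time G L (A (pverts G) s \<delta>))))"
proof -
  let ?c = "\<alpha> * (1 - \<alpha>)\<^sup>2 * (1 - \<epsilon>) * (1 - 2 * p\<^sub>f) / 2"
  have "0 < ?c" using assms by simp
  then show ?thesis
    by (intro exI[of _ 2] exI[of _ 6] exI[of _ ?c] conjI allI impI exists_hard_input)
      (use assms in auto)
qed

end
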